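(* Let $f : \mathbb{R}^{n}\rightarrow \mathbb{R}$ be differentiable at $x^{*}\in \mathbb{R}^{n}$. If $x^{*}$ is a local minimum of $f$, then $\nabla f(x^{*}) = 0$.
   Context: A point $x^*\in\mathbb{R}^n$ is a local minimum of $f$ if there exists $\varepsilon>0$ such that $f(x^* )\leq f(x)$ for all $x\in\mathbb{R}^n$ with $\|x^*-x\|\leq\varepsilon$. *)

theory Defs
  imports "HOL-Analysis.Analysis"
begin

definition local_minimum :: "(real ^ 'n \<Rightarrow> real) \<Rightarrow> real ^ 'n \<Rightarrow> bool" where
  "local_minimum f x \<longleftrightarrow> (\<exists>\<epsilon>>0. \<forall>y. norm (x - y) \<le> \<epsilon> \<longrightarrow> f x \<le> f y)"

(* THE is meaningful only where f is differentiable. There the gradient exists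
   and its components are the partial derivatives (gradient_component). *)
definition gradient :: "(real ^ 'n \<Rightarrow> real) \<Rightarrow> real ^ 'n \<Rightarrow> real ^ 'n" where
  "gradient f x = (THE D. GDERIV f x :> D)"

lemma gradient_eqI:
  assumes "GDERIV f x :> D"
  shows "gradient f x = D"
  unfolding gradient_def
proof (rule the_equality)
  show "GDERIV f x :> D" by (fact assms)
next
  fix E assume "GDERIV f x :> E"
  then have "(\<lambda>h. inner h E) = (\<lambda>h. inner h D)"
    using assms unfolding gderiv_def by (rule has_derivative_unique)
  then show "E = D"
    unfolding fun_eq_iff by (rule vector_eq_ldot[THEN iffD1])
qed

lemma differentiable_imp_gderiv_gradient:
  fixes f :: "real ^ 'n \<Rightarrow> real"
  assumes "f differentiable (at x)"
  shows "GDERIV f x :> gradient f x"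
proof -
  obtain f' where f': "(f has_derivative f') (at x)"
    using assms unfolding differentiable_def by blast
  then have "linear f'"
    by (rule has_derivative_linear)
  then have "f' h = inner h (adjoint f' 1)" for h
    using adjoint_works[of f' h 1] by simp
  then have "(\<lambda>h. inner h (adjoint f' 1)) = f'"
    by (intro ext) (rule sym)
  with f' have *: "GDERIV f x :> adjoint f' 1"
    by (simp add: gderiv_def)
  show ?thesis
    unfolding gradient_eqI[OF *] by (fact *)
qed

lemma gradient_component:
  fixes f :: "real ^ 'n \<Rightarrow> real"
  assumes "f differentiable (at x)"
  shows "((\<lambda>t. f (x + t *\<^sub>R axis i 1)) has_real_derivative gradient f x $ i) (at 0)"
proof -
  have "(f has_derivative (\<lambda>h. inner h (gradient f x))) (at (x + 0 *\<^sub>R axis i 1))"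
    using differentiable_imp_gderiv_gradient[OF assms] by (simp add: gderiv_def)
  moreover have "((\<lambda>t. x + t *\<^sub>R axis i 1) has_derivative (\<lambda>t. t *\<^sub>R axis i 1)) (at 0)"
    by (auto intro!: derivative_eq_intros)
  ultimately have "((\<lambda>t. f (x + t *\<^sub>R axis i 1)) has_derivative
      (\<lambda>t. inner (t *\<^sub>R axis i 1) (gradient f x))) (at 0)"
    by (rule has_derivative_compose[rotated])
  then show ?thesis
    by (rule has_derivative_imp_has_field_derivative) (simp add: inner_axis')
qed

end

theory Submission
  imports Defs
begin

text \<open>At an interior minimum the derivative is the zero functional
  (\<open>differential_zero_maxmin\<close>). It acts as the inner product with the gradient, so the
  gradient is orthogonal to every vector, itself included.\<close>

theorem theorem3p5:
  fixes f :: "real ^ 'n \<Rightarrow> real" and x :: "real ^ 'n"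
  assumes "f differentiable (at x)"
    and "local_minimum f x"
  shows "gradient f x = 0"
proof -
  obtain e where "e > 0" and e: "\<And>y. norm (x - y) \<le> e \<Longrightarrow> f x \<le> f y"
    using assms(2) unfolding local_minimum_def by blast
  have deriv: "(f has_derivative (\<lambda>h. inner h (gradient f x))) (at x)"
    using differentiable_imp_gderiv_gradient[OF assms(1)] by (simp add: gderiv_def)
  \<comment> \<open>Shrinking the closed ball of \<open>local_minimum\<close> to the open one gives
    the open set that the extremum lemma asks for.\<close>
  have "\<forall>y\<in>ball x e. f x \<le> f y"
    using e by (simp add: dist_norm)
  then have "(\<lambda>h. inner h (gradient f x)) = (\<lambda>h. 0)"
    using differential_zero_maxmin[OF _ open_ball deriv, of x e] \<open>e > 0\<close> by simp
  \<comment> \<open>Evaluation at \<open>h = gradient f x\<close>.\<close>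
  then have "inner (gradient f x) (gradient f x) = 0"
    by (rule fun_cong)
  then show ?thesis
    by simp
qed

end
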